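(* Let $j$ and $k$ be nonnegative integers and let $n$ be a positive integer. Then there is an $n$-by-$n$ complex matrix $A$ with $p(A)=j$ and $a(A)=k$ if and only if one of the following conditions holds: (a) $j=k\le n-1$; (b) $j\le k-1$ and $j+k\le n-1$; (c) $j\le k-2$ and $j+k=n$.
   Context: An $n$-by-$n$ complex matrix $A$ is a partial isometry if $\|Ax\|=\|x\|$ (Euclidean norm) for all $x\in\mathbb{C}^n$ in the orthogonal complement $(\ker A)^{\perp}$ of $\ker A$. The power partial isometry index $p(A)\in\{0,1,2,\ldots\}\cup\{\infty\}$ is the supremum of the nonnegative integers $j$ for which $I, A, A^2, \ldots, A^j$ are all partial isometries. The ascent $a(A)$ is the smallest nonnegative integer $k$ for which $\ker A^k=\ker A^{k+1}$, where $A^0=I$. *)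

theory Defs
  imports
    "Jordan_Normal_Form.Matrix_Kernel"
    "HOL-Analysis.L2_Norm"
    "HOL-Library.Extended_Nat"
begin

definition eucl_norm :: "complex vec \<Rightarrow> real" where
  "eucl_norm v = L2_set (\<lambda>i. cmod (v $ i)) {..<dim_vec v}"

(* With respect to the Hermitian inner product; VS_Connect.orthogonal_complement
   uses the bilinear form without conjugation. *)
definition orth_compl :: "nat \<Rightarrow> complex vec set \<Rightarrow> complex vec set" where
  "orth_compl n W = {x \<in> carrier_vec n. \<forall>y\<in>W. x \<bullet>c y = 0}"

definition partial_isometry :: "complex mat \<Rightarrow> bool" where
  "partial_isometry A \<longleftrightarrow>
     (\<forall>x \<in> orth_compl (dim_col A) (mat_kernel A). eucl_norm (A *\<^sub>v x) = eucl_norm x)"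

(* The set is nonempty for square A, since the identity A ^\<^sub>m 0 is a partial isometry. *)
definition ppi_index :: "complex mat \<Rightarrow> enat" where
  "ppi_index A = Sup {enat j | j. \<forall>i\<le>j. partial_isometry (A ^\<^sub>m i)}"

(* For square A such k exists by finite dimensionality, so LEAST is well defined. *)
definition ascent :: "complex mat \<Rightarrow> nat" where
  "ascent A = (LEAST k. mat_kernel (A ^\<^sub>m k) = mat_kernel (A ^\<^sub>m (k + 1)))"

end

theory Submission
  imports Defs
begin

text \<open>
  If \<open>A\<close>, \<open>A\<^sup>i\<close> and \<open>A\<^sup>i\<^sup>+\<^sup>1\<close> are partial isometries, then \<open>A\<close> maps \<open>(ker A\<^sup>i\<^sup>+\<^sup>1)\<^sup>\<bottom>\<close>
  isometrically into \<open>(ker A\<^sup>i)\<^sup>\<bottom>\<close>. Hence all powers are partial isometries once this holds one step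
  beyond the ascent, so a finite index \<open>j\<close> is at most the ascent \<open>k\<close>. If \<open>1 \<le> j < k\<close>, the
  increment \<open>dim ker A\<^sup>j - dim ker A\<^sup>j\<^sup>-\<^sup>1\<close> is at least \<open>2\<close>, for otherwise \<open>A\<^sup>j\<^sup>+\<^sup>1\<close> would also be a
  partial isometry. The increments being nonincreasing, \<open>dim ker A\<^sup>k \<ge> j + k\<close>. Equality with \<open>n\<close>
  forces \<open>A\<^sup>k = 0\<close>, and then \<open>A\<^sup>j\<^sup>+\<^sup>1\<close> is not a partial isometry only if \<open>j + 1 < k\<close>. Conversely, the
  examples are weighted shifts in which one basis vector is sent to a combination of two basis
  vectors with different annihilation orders.
\<close>

section \<open>Orthogonal complements of kernels\<close>

lemma cscalar_self: "v \<bullet>c v = complex_of_real ((eucl_norm v)\<^sup>2)"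
proof -
  have "v \<bullet>c v = (\<Sum>i<dim_vec v. complex_of_real ((cmod (v $ i))\<^sup>2))"
    by (simp add: scalar_prod_def lessThan_atLeast0 complex_norm_square del: of_real_power)
  moreover have "(eucl_norm v)\<^sup>2 = (\<Sum>i<dim_vec v. (cmod (v $ i))\<^sup>2)"
    unfolding eucl_norm_def L2_set_def by (simp add: sum_nonneg)
  ultimately show ?thesis by simp
qed

lemma eucl_norm_nonneg: "0 \<le> eucl_norm v"
  by (simp add: eucl_norm_def)

lemma eucl_norm_eq_iff: "eucl_norm v = eucl_norm w \<longleftrightarrow> v \<bullet>c v = w \<bullet>c w"
  unfolding cscalar_self of_real_eq_iff using eucl_norm_nonneg by (simp add: power2_eq_iff_nonneg)

context
  fixes n :: nat
begin

lemma cscalar_add_left: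
  "u \<in> carrier_vec n \<Longrightarrow> v \<in> carrier_vec n \<Longrightarrow> w \<in> carrier_vec n \<Longrightarrow>
    (u + v) \<bullet>c w = u \<bullet>c w + v \<bullet>c (w :: complex vec)"
  by (rule add_scalar_prod_distrib) auto

lemma cscalar_add_right:
  "u \<in> carrier_vec n \<Longrightarrow> v \<in> carrier_vec n \<Longrightarrow> w \<in> carrier_vec n \<Longrightarrow>
    w \<bullet>c (u + v) = w \<bullet>c u + w \<bullet>c (v :: complex vec)"
  by (subst conjugate_add_vec[of _ n], auto intro!: scalar_prod_add_distrib)

lemma cscalar_smult_left:
  "u \<in> carrier_vec n \<Longrightarrow> w \<in> carrier_vec n \<Longrightarrow> (c \<cdot>\<^sub>v u) \<bullet>c w = c * (u \<bullet>c (w :: complex vec))"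
  by simp

lemma cscalar_smult_right:
  "u \<in> carrier_vec n \<Longrightarrow> w \<in> carrier_vec n \<Longrightarrow> w \<bullet>c (c \<cdot>\<^sub>v u) = cnj c * (w \<bullet>c (u :: complex vec))"
  by (simp add: conjugate_smult_vec)

lemma cscalar_commute:
  "u \<in> carrier_vec n \<Longrightarrow> w \<in> carrier_vec n \<Longrightarrow> w \<bullet>c u = cnj (u \<bullet>c (w :: complex vec))"
  by (auto simp: scalar_prod_def mult.commute)

lemmas cscalar_simps = cscalar_add_left cscalar_add_right cscalar_smult_left cscalar_smult_right

definition linear_subspace :: "complex vec set \<Rightarrow> bool" where
  "linear_subspace V \<longleftrightarrow> V \<subseteq> carrier_vec n \<and> 0\<^sub>v n \<in> V \<and>
     (\<forall>x\<in>V. \<forall>y\<in>V. x + y \<in> V) \<and> (\<forall>c. \<forall>x\<in>V. c \<cdot>\<^sub>v x \<in> V)"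

lemma linear_subspace_kernel:
  assumes A: "A \<in> carrier_mat m n"
  shows "linear_subspace (mat_kernel A)"
  using A unfolding linear_subspace_def mat_kernel[OF A]
  by (auto simp: mult_add_distrib_mat_vec[OF A] mult_mat_vec[OF A])

lemma linear_subspace_orth_compl:
  assumes "W \<subseteq> carrier_vec n"
  shows "linear_subspace (orth_compl n W)"
  using assms unfolding linear_subspace_def orth_compl_def
  by (auto simp: subset_iff cscalar_add_left cscalar_smult_left)

text \<open>Gram--Schmidt on the constraints: one hyperplane is intersected at a time, and only the
  component of its normal vector inside the previous space matters.\<close>

lemma hyperplanes_decomp:
  fixes u :: "nat \<Rightarrow> complex vec"
  assumes u: "\<And>i. i < r \<Longrightarrow> u i \<in> carrier_vec n"
  defines "W \<equiv> \<lambda>s. {x \<in> carrier_vec n. \<forall>i<s. x \<bullet>c u i = 0}"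
  assumes y: "y \<in> carrier_vec n"
  shows "\<exists>p\<in>W r. \<exists>q\<in>orth_compl n (W r). y = p + q"
  using u y
proof (induction r arbitrary: y)
  case 0
  have "y \<in> W 0" "0\<^sub>v n \<in> orth_compl n (W 0)" "y = y + 0\<^sub>v n"
    using 0 by (auto simp: W_def orth_compl_def)
  then show ?case by blast
next
  case (Suc r)
  have Wc: "\<And>s. W s \<subseteq> carrier_vec n" by (auto simp: W_def)
  have mono: "W (Suc r) \<subseteq> W r" by (auto simp: W_def)
  obtain p q where pq: "p \<in> W r" "q \<in> orth_compl n (W r)" "y = p + q"
    using Suc by (metis less_SucI)
  obtain u1 u2 where u12: "u1 \<in> W r" "u2 \<in> orth_compl n (W r)" "u r = u1 + u2"
    using Suc(1)[of "u r"] Suc(2) by (metis less_Suc_eq)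
  have pc: "p \<in> carrier_vec n" and u1c: "u1 \<in> carrier_vec n" using pq u12 Wc by auto
  have qc: "q \<in> carrier_vec n" and u2c: "u2 \<in> carrier_vec n" using pq u12 by (auto simp: orth_compl_def)
  have W_ur: "x \<bullet>c u r = x \<bullet>c u1" if "x \<in> W r" for x
  proof -
    have xc: "x \<in> carrier_vec n" using that Wc by auto
    have "x \<bullet>c u2 = cnj (u2 \<bullet>c x)" using cscalar_commute[OF u2c xc] .
    also have "\<dots> = 0" using u12(2) that by (simp add: orth_compl_def)
    finally show ?thesis using u12(3) by (simp add: cscalar_add_right[OF u1c u2c xc])
  qed
  have WS: "x \<in> W (Suc r) \<longleftrightarrow> x \<in> W r \<and> x \<bullet>c u1 = 0" for x
    using W_ur[of x] by (auto simp: W_def less_Suc_eq)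
  \<comment> \<open>The coefficient projecting \<open>p\<close> onto \<open>u1\<close>. For
    \<open>u1 = 0\<close> division by zero yields \<open>c = 0\<close>, and
    \<open>p \<bullet>c u1\<close> vanishes already.\<close>
  define c where "c = (p \<bullet>c u1) / (u1 \<bullet>c u1)"
  define p' where "p' = p + (- c) \<cdot>\<^sub>v u1"
  define q' where "q' = q + c \<cdot>\<^sub>v u1"
  have p'W: "p' \<in> W r"
    using pq(1) u12(1) unfolding W_def p'_def
    using Suc.prems(1) by (auto simp: cscalar_simps)
  have "p' \<bullet>c u1 = (p \<bullet>c u1) - c * (u1 \<bullet>c u1)"
    unfolding p'_def using pc u1c by (simp add: cscalar_simps)
  also have "\<dots> = 0"
    using pc conjugate_square_eq_0_vec[OF u1c] by (cases "u1 = 0\<^sub>v n") (auto simp: c_def)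
  finally have "p' \<in> W (Suc r)" using p'W WS by simp
  moreover have "q' \<in> orth_compl n (W (Suc r))"
  proof -
    have "q' \<bullet>c x = 0" if x: "x \<in> W (Suc r)" for x
    proof -
      have xc: "x \<in> carrier_vec n" using x Wc by auto
      have "u1 \<bullet>c x = cnj (x \<bullet>c u1)" using cscalar_commute[OF xc u1c] .
      then have "u1 \<bullet>c x = 0" using x WS by simp
      moreover have "q \<bullet>c x = 0" using pq(2) x mono by (auto simp: orth_compl_def)
      ultimately show ?thesis unfolding q'_def using qc u1c xc by (simp add: cscalar_simps)
    qed
    moreover have "q' \<in> carrier_vec n" unfolding q'_def using qc u1c by auto
    ultimately show ?thesis by (auto simp: orth_compl_def)
  qed
  moreover have "y = p' + q'"
    unfolding pq(3) p'_def q'_def by (rule eq_vecI) (use pc qc u1c in auto)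
  ultimately show ?case by blast
qed

text \<open>The kernel is cut out by the hyperplanes orthogonal to the conjugated rows, so the
  hyperplane decomposition applies.\<close>

lemma kernel_decomp:
  assumes A: "A \<in> carrier_mat m n" and y: "y \<in> carrier_vec n"
  obtains p q where "p \<in> mat_kernel A" "q \<in> orth_compl n (mat_kernel A)" "y = p + q"
proof -
  have "mat_kernel A = {x \<in> carrier_vec n. \<forall>i<m. x \<bullet>c conjugate (row A i) = 0}"
  proof -
    have "A *\<^sub>v x = 0\<^sub>v m \<longleftrightarrow> (\<forall>i<m. x \<bullet>c conjugate (row A i) = 0)" if x: "x \<in> carrier_vec n" for x
    proof -
      have "A *\<^sub>v x = 0\<^sub>v m \<longleftrightarrow> (\<forall>i<m. row A i \<bullet> x = 0)"
        using A by (auto simp: vec_eq_iff)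
      moreover have "row A i \<bullet> x = x \<bullet>c conjugate (row A i)" for i
        using A x comm_scalar_prod[of "row A i" n x] by auto
      ultimately show ?thesis by simp
    qed
    then show ?thesis unfolding mat_kernel[OF A] by auto
  qed
  then show thesis
    using hyperplanes_decomp[of m "\<lambda>i. conjugate (row A i)" y] A y that by auto
qed

section \<open>Partial isometries and preservation of inner products\<close>

lemma partial_isometryD:
  assumes "partial_isometry A" "A \<in> carrier_mat m n" "x \<in> orth_compl n (mat_kernel A)"
  shows "(A *\<^sub>v x) \<bullet>c (A *\<^sub>v x) = x \<bullet>c x"
  using assms unfolding partial_isometry_def by (auto simp: eucl_norm_eq_iff[symmetric])

lemma partial_isometryI:
  assumes "A \<in> carrier_mat m n"
    and "\<And>x. x \<in> orth_compl n (mat_kernel A) \<Longrightarrow> (A *\<^sub>v x) \<bullet>c (A *\<^sub>v x) = x \<bullet>c x"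
  shows "partial_isometry A"
  using assms unfolding partial_isometry_def by (auto simp: eucl_norm_eq_iff)

text \<open>In \<open>y = p + q\<close> the kernel part \<open>p\<close> is lost while
  \<open>q\<close> keeps its norm, so Pythagoras forces \<open>p = 0\<close>. This converts equality
  of norms into orthogonality to the kernel.\<close>

lemma partial_isometry_norm_attained:
  assumes pi: "partial_isometry A" and A: "A \<in> carrier_mat m n" and y: "y \<in> carrier_vec n"
    and eq: "(A *\<^sub>v y) \<bullet>c (A *\<^sub>v y) = y \<bullet>c y"
  shows "y \<in> orth_compl n (mat_kernel A)"
proof -
  obtain p q where pq: "p \<in> mat_kernel A" "q \<in> orth_compl n (mat_kernel A)" "y = p + q"
    using kernel_decomp[OF A y] .
  have p: "p \<in> carrier_vec n" "A *\<^sub>v p = 0\<^sub>v m" using mat_kernelD[OF A pq(1)] .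
  have q: "q \<in> carrier_vec n" using pq(2) by (simp add: orth_compl_def)
  have qp: "q \<bullet>c p = 0" using pq by (simp add: orth_compl_def)
  then have "p \<bullet>c q = 0" using cscalar_commute[OF q p(1)] by simp
  then have "y \<bullet>c y = p \<bullet>c p + q \<bullet>c q"
    unfolding pq(3) using p q qp by (simp add: cscalar_simps)
  moreover have "A *\<^sub>v y = A *\<^sub>v q"
    unfolding pq(3) using A p q by (simp add: mult_add_distrib_mat_vec[OF A])
  ultimately have "p \<bullet>c p = 0" using eq partial_isometryD[OF pi A pq(2)] by simp
  then have "p = 0\<^sub>v n" using conjugate_square_eq_0_vec[OF p(1)] by simp
  then show ?thesis using pq q by simp
qed

text \<open>Polarization: comparing the norms of \<open>z + c \<cdot>\<^sub>v x\<close> and of its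
  image leaves only cross terms; \<open>c = 1\<close> kills the real part of \<open>?h\<close> and
  \<open>c = \<i>\<close> the imaginary part.\<close>

lemma isometric_preserves_orthogonality:
  assumes A: "A \<in> carrier_mat m n" and V: "linear_subspace V"
    and iso: "\<And>x. x \<in> V \<Longrightarrow> (A *\<^sub>v x) \<bullet>c (A *\<^sub>v x) = x \<bullet>c x"
    and x: "x \<in> V" and z: "z \<in> V" and orth: "z \<bullet>c x = 0"
  shows "(A *\<^sub>v z) \<bullet>c (A *\<^sub>v x) = 0"
proof -
  have xc: "x \<in> carrier_vec n" and zc: "z \<in> carrier_vec n"
    using V x z by (auto simp: linear_subspace_def)
  let ?h = "(A *\<^sub>v z) \<bullet>c (A *\<^sub>v x)"
  have xz: "x \<bullet>c z = 0" using cscalar_commute[OF zc xc] orth by simp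
  have h': "(A *\<^sub>v x) \<bullet>c (A *\<^sub>v z) = cnj ?h"
    using A xc zc by (auto simp: scalar_prod_def mult.commute)
  have expand: "cnj c * ?h + c * cnj ?h = 0" for c
  proof -
    have cz: "(A *\<^sub>v z) \<in> carrier_vec m" "(A *\<^sub>v x) \<in> carrier_vec m" using A xc zc by auto
    have "z + c \<cdot>\<^sub>v x \<in> V" using V x z by (simp add: linear_subspace_def)
    from iso[OF this] have "(A *\<^sub>v z + c \<cdot>\<^sub>v (A *\<^sub>v x)) \<bullet>c (A *\<^sub>v z + c \<cdot>\<^sub>v (A *\<^sub>v x))
        = (z + c \<cdot>\<^sub>v x) \<bullet>c (z + c \<cdot>\<^sub>v x)"
      using A xc zc by (simp add: mult_add_distrib_mat_vec[OF A] mult_mat_vec[OF A])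
    also have "(A *\<^sub>v z + c \<cdot>\<^sub>v (A *\<^sub>v x)) \<bullet>c (A *\<^sub>v z + c \<cdot>\<^sub>v (A *\<^sub>v x))
        = (A *\<^sub>v z) \<bullet>c (A *\<^sub>v z) + cnj c * ?h + c * (cnj ?h + cnj c * ((A *\<^sub>v x) \<bullet>c (A *\<^sub>v x)))"
      using cz by (simp add: conjugate_add_vec[of _ m] conjugate_smult_vec
          add_scalar_prod_distrib[of _ m] scalar_prod_add_distrib[of _ m] h' algebra_simps)
    also have "(z + c \<cdot>\<^sub>v x) \<bullet>c (z + c \<cdot>\<^sub>v x) = z \<bullet>c z + c * (cnj c * (x \<bullet>c x))"
      using xc zc by (simp add: cscalar_simps xz orth)
    finally show ?thesis using iso[OF x] iso[OF z] by (simp add: algebra_simps)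
  qed
  from expand[of 1] expand[of \<i>] show ?thesis
    by (simp add: complex_eq_iff)
qed

end

section \<open>Kernels of powers\<close>

text \<open>This replaces a dimension count: vectors \<open>f i\<close> in \<open>V (Suc i)\<close>
  outside \<open>V i\<close> are linearly independent, so \<open>n\<close> of them form the columns
  of an invertible matrix whose range lies in \<open>V n\<close>.\<close>

lemma subspace_chain:
  fixes V :: "nat \<Rightarrow> complex vec set"
  assumes sub: "\<And>i. i \<le> m \<Longrightarrow> linear_subspace n (V i)"
    and strict: "\<And>i. i < m \<Longrightarrow> V i \<subset> V (Suc i)"
  shows "m \<le> n" and "m = n \<Longrightarrow> V m = carrier_vec n"
proof -
  have full: "V n = carrier_vec n" if "n \<le> m"
  proof -
    have "\<forall>i<n. \<exists>v. v \<in> V (Suc i) \<and> v \<notin> V i"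
      using strict that by (meson order_less_le_trans psubset_imp_ex_mem DiffE)
    then obtain f where f: "\<And>i. i < n \<Longrightarrow> f i \<in> V (Suc i)" "\<And>i. i < n \<Longrightarrow> f i \<notin> V i"
      by metis
    have sub': "linear_subspace n (V i)" if "i \<le> n" for i using sub that \<open>n \<le> m\<close> by simp
    have fc: "f i \<in> carrier_vec n" if "i < n" for i
      using f(1)[OF that] sub'[of "Suc i"] that by (auto simp: linear_subspace_def)
    define M where "M = mat n n (\<lambda>(r, i). f i $ r)"
    define P where "P x t = vec n (\<lambda>r. \<Sum>i<t. x $ i * f i $ r)" for x :: "complex vec" and t
    have M: "M \<in> carrier_mat n n" by (simp add: M_def)
    have Mx: "M *\<^sub>v x = P x n" if "x \<in> carrier_vec n" for x
      using that by (auto simp: M_def P_def scalar_prod_def lessThan_atLeast0 mult.commute intro!: eq_vecI sum.cong)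
    have P_Suc: "P x (Suc t) = P x t + x $ t \<cdot>\<^sub>v f t" if "t < n" for x t
      using fc[OF that] by (auto simp: P_def intro!: eq_vecI)
    have PV: "P x t \<in> V t" if "t \<le> n" for x t
      using that
    proof (induction t)
      case 0
      have "P x 0 = 0\<^sub>v n" by (auto simp: P_def)
      then show ?case using sub'[of 0] by (simp add: linear_subspace_def)
    next
      case (Suc t)
      then have "P x t \<in> V (Suc t)" using strict[of t] that \<open>n \<le> m\<close> by auto
      then show ?case
        using Suc.prems sub'[of "Suc t"] f(1)[of t] P_Suc[of t x] by (simp add: linear_subspace_def)
    qed
    have "det M \<noteq> 0"
    proof
      assume "det M = 0"
      then obtain x where x: "x \<in> carrier_vec n" "x \<noteq> 0\<^sub>v n" "M *\<^sub>v x = 0\<^sub>v n"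
        using det_0_iff_vec_prod_zero_field[OF M] by auto
      \<comment> \<open>The last nonzero coordinate \<open>t\<close> of a null vector of
        \<open>M\<close> would make \<open>f t\<close> a multiple of \<open>P x t\<close>, which
        lies in \<open>V t\<close>.\<close>
      define S where "S = {i. i < n \<and> x $ i \<noteq> 0}"
      have S: "finite S" "S \<noteq> {}" using x(1,2) by (auto simp: S_def vec_eq_iff)
      define t where "t = Max S"
      have t: "t < n" "x $ t \<noteq> 0" using Max_in[OF S] by (auto simp: t_def S_def)
      have above: "x $ i = 0" if "t < i" "i < n" for i
        using that Max_ge[OF S(1), of i] by (fastforce simp: t_def S_def)
      have "P x n = P x (Suc t)"
      proof -
        have "(\<Sum>i<n. x $ i * f i $ r) = (\<Sum>i<Suc t. x $ i * f i $ r)" for r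
          by (rule sum.mono_neutral_right) (use t above in \<open>auto simp: not_less_eq\<close>)
        then show ?thesis by (simp add: P_def)
      qed
      then have zero: "P x t + x $ t \<cdot>\<^sub>v f t = 0\<^sub>v n" using Mx[OF x(1)] x(3) P_Suc[OF t(1)] by simp
      have "f t = (- inverse (x $ t)) \<cdot>\<^sub>v P x t"
      proof (rule eq_vecI)
        fix r assume "r < dim_vec ((- inverse (x $ t)) \<cdot>\<^sub>v P x t)"
        then have r: "r < n" by (simp add: P_def)
        have "(P x t + x $ t \<cdot>\<^sub>v f t) $ r = 0" using zero r by simp
        then have "P x t $ r + x $ t * f t $ r = 0" using r fc[OF t(1)] by simp
        then show "f t $ r = ((- inverse (x $ t)) \<cdot>\<^sub>v P x t) $ r"
          using t(2) r by (simp add: P_def field_simps eq_neg_iff_add_eq_0)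
      qed (use fc[OF t(1)] in \<open>simp add: P_def\<close>)
      then show False using PV[of t x] t f(2)[of t] sub'[of t] by (simp add: linear_subspace_def)
    qed
    from det_non_zero_imp_unit[OF M this, of "()"]
    obtain B where B: "M * B = 1\<^sub>m n" "B \<in> carrier_mat n n"
      by (auto simp: Units_def ring_mat_def)
    have "y \<in> V n" if y: "y \<in> carrier_vec n" for y
    proof -
      have "M *\<^sub>v (B *\<^sub>v y) = y" using assoc_mult_mat_vec[OF M B(2) y] B y by simp
      then show ?thesis using Mx[of "B *\<^sub>v y"] B y PV[of n "B *\<^sub>v y"] by simp
    qed
    then show ?thesis using sub'[of n] by (auto simp: linear_subspace_def)
  qed
  show "m \<le> n"
  proof (rule ccontr)
    assume "\<not> m \<le> n"
    then have "V n \<subset> V (Suc n)" "V (Suc n) \<subseteq> carrier_vec n"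
      using strict[of n] sub[of "Suc n"] by (auto simp: linear_subspace_def)
    then show False using full \<open>\<not> m \<le> n\<close> by auto
  qed
  show "m = n \<Longrightarrow> V m = carrier_vec n" using full by simp
qed

lemma pow_mat_add:
  assumes "A \<in> carrier_mat n n"
  shows "A ^\<^sub>m (i + l) = A ^\<^sub>m i * A ^\<^sub>m l"
proof (induction l)
  case (Suc l)
  then show ?case using assms by (simp add: assoc_mult_mat[of _ n n _ n _ n])
qed (use assms in simp)

lemma pow_mat_add_vec:
  assumes "A \<in> carrier_mat n n" "v \<in> carrier_vec n"
  shows "A ^\<^sub>m (i + l) *\<^sub>v v = A ^\<^sub>m i *\<^sub>v (A ^\<^sub>m l *\<^sub>v v)"
  using assms by (simp add: pow_mat_add[OF assms(1)] assoc_mult_mat_vec[of _ n n _ n])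

text \<open>The set under the supremum is downward closed, and its supremum is \<open>enat j\<close>
  exactly when it is at least \<open>enat j\<close> but not at least
  \<open>enat (Suc j)\<close>.\<close>

lemma ppi_index_eq_iff:
  "ppi_index A = enat j \<longleftrightarrow>
    (\<forall>i\<le>j. partial_isometry (A ^\<^sub>m i)) \<and> \<not> partial_isometry (A ^\<^sub>m Suc j)"
  if "partial_isometry (A ^\<^sub>m 0)"
proof -
  define S where "S = {enat l | l. \<forall>i\<le>l. partial_isometry (A ^\<^sub>m i)}"
  have idx: "ppi_index A = Sup S" by (simp add: ppi_index_def S_def)
  have mem: "enat l \<in> S \<longleftrightarrow> (\<forall>i\<le>l. partial_isometry (A ^\<^sub>m i))" for l by (auto simp: S_def)
  have down: "enat l \<in> S" if "enat l \<le> Sup S" for l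
  proof (rule ccontr)
    assume "enat l \<notin> S"
    then obtain i where i: "i \<le> l" "\<not> partial_isometry (A ^\<^sub>m i)" by (auto simp: mem)
    have "x \<le> enat (l - 1)" if xS: "x \<in> S" for x
    proof -
      obtain q where q: "x = enat q" "\<forall>i\<le>q. partial_isometry (A ^\<^sub>m i)" using xS unfolding S_def by blast
      then have "q < i" using i by (meson not_le)
      then show ?thesis using q i by simp
    qed
    then have "Sup S \<le> enat (l - 1)" by (rule Sup_least)
    then have "enat l \<le> enat (l - 1)" using that by (rule order.trans[rotated])
    \<comment> \<open>Truncated subtraction leaves \<open>l = 0\<close>, hence \<open>i = 0\<close>,
      where the hypothesis on the zeroth power contradicts the choice of \<open>i\<close>.\<close>
    then have "l = 0" by simp
    then show False using i \<open>partial_isometry (A ^\<^sub>m 0)\<close> by simp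
  qed
  have up: "enat l \<in> S \<Longrightarrow> enat l \<le> Sup S" for l by (rule Sup_upper)
  have iff: "enat l \<le> Sup S \<longleftrightarrow> (\<forall>i\<le>l. partial_isometry (A ^\<^sub>m i))" for l
    using up down mem by metis
  have "Sup S = enat j \<longleftrightarrow> enat j \<le> Sup S \<and> \<not> enat (Suc j) \<le> Sup S"
    by (cases "Sup S") auto
  then show ?thesis unfolding idx iff by (auto simp: le_Suc_eq)
qed

context
  fixes n :: nat and A :: "complex mat"
  assumes A: "A \<in> carrier_mat n n"
begin

lemma pow_carrier: "A ^\<^sub>m i \<in> carrier_mat n n"
  using A by simp

lemma pow_vec_carrier: "v \<in> carrier_vec n \<Longrightarrow> A ^\<^sub>m i *\<^sub>v v \<in> carrier_vec n"
  using mult_mat_vec_carrier[OF pow_carrier] .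

lemma pow_mat_zero_vec: "A ^\<^sub>m i *\<^sub>v 0\<^sub>v n = 0\<^sub>v n"
  using pow_carrier[of i] A by (auto intro!: eq_vecI)

lemma pow_kernel_iff: "v \<in> mat_kernel (A ^\<^sub>m i) \<longleftrightarrow> v \<in> carrier_vec n \<and> A ^\<^sub>m i *\<^sub>v v = 0\<^sub>v n"
  unfolding mat_kernel[OF pow_carrier] by simp

lemma pow_kernel_add_iff:
  "v \<in> mat_kernel (A ^\<^sub>m (i + l)) \<longleftrightarrow> v \<in> carrier_vec n \<and> A ^\<^sub>m l *\<^sub>v v \<in> mat_kernel (A ^\<^sub>m i)"
  by (auto simp: pow_kernel_iff pow_mat_add_vec[OF A] pow_vec_carrier)

lemma pow_kernel_mono: "i \<le> l \<Longrightarrow> mat_kernel (A ^\<^sub>m i) \<subseteq> mat_kernel (A ^\<^sub>m l)"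
  using pow_mat_add_vec[OF A, of _ "l - i" i] by (auto simp: pow_kernel_iff pow_mat_zero_vec)

lemma pow_kernel_stable:
  assumes eq: "mat_kernel (A ^\<^sub>m i) = mat_kernel (A ^\<^sub>m Suc i)" and "i \<le> l"
  shows "mat_kernel (A ^\<^sub>m l) = mat_kernel (A ^\<^sub>m i)"
  using \<open>i \<le> l\<close>
proof (induction l rule: dec_induct)
  case (step l)
  have "v \<in> mat_kernel (A ^\<^sub>m Suc l) \<longleftrightarrow> v \<in> mat_kernel (A ^\<^sub>m l)" for v
    using pow_kernel_add_iff[of v i "l - i"] pow_kernel_add_iff[of v "Suc i" "l - i"] step(1) eq
    by simp
  then show ?case using step by blast
qed simp

text \<open>By stability, a strict inclusion at exponent \<open>n\<close> would make all kernels up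
  to exponent \<open>n + 1\<close> strictly increase, too long a chain in dimension
  \<open>n\<close>.\<close>

lemma ascent_le: "ascent A \<le> n"
  and ascent_kernel: "mat_kernel (A ^\<^sub>m ascent A) = mat_kernel (A ^\<^sub>m Suc (ascent A))"
proof -
  have "mat_kernel (A ^\<^sub>m n) = mat_kernel (A ^\<^sub>m (n + 1))"
  proof (rule ccontr)
    assume ne: "\<not> ?thesis"
    have "mat_kernel (A ^\<^sub>m i) \<subset> mat_kernel (A ^\<^sub>m Suc i)" if "i < Suc n" for i
      using pow_kernel_mono[of i "Suc i"] pow_kernel_stable[of i n] pow_kernel_stable[of i "n + 1"] ne that
      by (metis Suc_eq_plus1 le_SucI less_Suc_eq_le order.refl psubsetI)
    then have "Suc n \<le> n"
      using subspace_chain(1)[of "Suc n" n "\<lambda>i. mat_kernel (A ^\<^sub>m i)"] linear_subspace_kernel[OF pow_carrier]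
      by blast
    then show False by simp
  qed
  then show "ascent A \<le> n" "mat_kernel (A ^\<^sub>m ascent A) = mat_kernel (A ^\<^sub>m Suc (ascent A))"
    unfolding ascent_def Suc_eq_plus1 by (rule Least_le, rule LeastI)
qed

lemma ascent_strict: "i < ascent A \<Longrightarrow> mat_kernel (A ^\<^sub>m i) \<subset> mat_kernel (A ^\<^sub>m Suc i)"
  using pow_kernel_mono[of i "Suc i"] not_less_Least[of i] unfolding ascent_def by fastforce

lemma orth_compl_pow_kernel_mono:
  "i \<le> l \<Longrightarrow> orth_compl n (mat_kernel (A ^\<^sub>m l)) \<subseteq> orth_compl n (mat_kernel (A ^\<^sub>m i))"
  using pow_kernel_mono[of i l] by (auto simp: orth_compl_def)

lemma pow_1: "A ^\<^sub>m 1 = A"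
  using A by simp

section \<open>How \<open>A\<close> acts between the complements of successive kernels\<close>

text \<open>Both \<open>A\<close> and \<open>A ^\<^sub>m Suc i\<close> preserve the norm of
  \<open>x\<close>, so \<open>A ^\<^sub>m i\<close> preserves that of \<open>A *\<^sub>v x\<close>;
  attaining the norm puts this vector in the complement.\<close>

lemma ppi_step:
  assumes pi: "partial_isometry A" "partial_isometry (A ^\<^sub>m i)" "partial_isometry (A ^\<^sub>m Suc i)"
    and x: "x \<in> orth_compl n (mat_kernel (A ^\<^sub>m Suc i))"
  shows "(A *\<^sub>v x) \<bullet>c (A *\<^sub>v x) = x \<bullet>c x"
    and "A *\<^sub>v x \<in> orth_compl n (mat_kernel (A ^\<^sub>m i))"
proof -
  have xc: "x \<in> carrier_vec n" using x by (simp add: orth_compl_def)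
  have "x \<in> orth_compl n (mat_kernel A)"
    using orth_compl_pow_kernel_mono[of 1 "Suc i"] x A by auto
  then show *: "(A *\<^sub>v x) \<bullet>c (A *\<^sub>v x) = x \<bullet>c x" using partial_isometryD[OF pi(1) A] by simp
  have "A ^\<^sub>m Suc i *\<^sub>v x = A ^\<^sub>m i *\<^sub>v (A *\<^sub>v x)"
    using pow_mat_add_vec[OF A xc, of i 1] pow_1 by simp
  then have "(A ^\<^sub>m i *\<^sub>v (A *\<^sub>v x)) \<bullet>c (A ^\<^sub>m i *\<^sub>v (A *\<^sub>v x)) = (A *\<^sub>v x) \<bullet>c (A *\<^sub>v x)"
    using partial_isometryD[OF pi(3) pow_carrier x] * by simp
  then show "A *\<^sub>v x \<in> orth_compl n (mat_kernel (A ^\<^sub>m i))"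
    using partial_isometry_norm_attained[OF pi(2) pow_carrier] A xc by simp
qed

text \<open>At a stable kernel \<open>A\<close> maps \<open>?M\<close> isometrically into itself,
  and \<open>?M\<close> is also the complement of the kernel of every later power.\<close>

lemma partial_isometry_beyond_ascent:
  assumes eq: "mat_kernel (A ^\<^sub>m k) = mat_kernel (A ^\<^sub>m Suc k)"
    and pi: "partial_isometry A" "partial_isometry (A ^\<^sub>m k)" "partial_isometry (A ^\<^sub>m Suc k)"
    and "k \<le> l"
  shows "partial_isometry (A ^\<^sub>m l)"
proof -
  let ?M = "orth_compl n (mat_kernel (A ^\<^sub>m k))"
  have "A ^\<^sub>m i *\<^sub>v x \<in> ?M \<and> (A ^\<^sub>m i *\<^sub>v x) \<bullet>c (A ^\<^sub>m i *\<^sub>v x) = x \<bullet>c x" if x: "x \<in> ?M" for x i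
  proof (induction i)
    case 0
    then show ?case using A x by (auto simp: orth_compl_def)
  next
    case (Suc i)
    have "A ^\<^sub>m Suc i *\<^sub>v x = A *\<^sub>v (A ^\<^sub>m i *\<^sub>v x)"
      using pow_mat_add_vec[OF A, of x 1 i] x pow_1 by (simp add: orth_compl_def)
    then show ?case using ppi_step[OF pi] Suc eq by metis
  qed
  then show ?thesis
    using pow_kernel_stable[OF eq \<open>k \<le> l\<close>] by (intro partial_isometryI[OF pow_carrier]) simp
qed

text \<open>Some \<open>x\<close> in \<open>ker A\<^sup>j\<^sup>+\<^sup>2\<close> has \<open>A x\<close> spanning \<open>ker A\<^sup>j\<^sup>+\<^sup>1\<close> modulo \<open>ker A\<^sup>j\<close>, and \<open>A\<close> maps
  \<open>(ker A\<^sup>j\<^sup>+\<^sup>2)\<^sup>\<bottom>\<close> to vectors orthogonal to \<open>A x\<close>.\<close>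

lemma partial_isometry_Suc_if_increment_1:
  assumes pi: "\<And>i. i \<le> Suc j \<Longrightarrow> partial_isometry (A ^\<^sub>m i)"
    and v: "v \<in> carrier_vec n"
    and span: "\<And>w. w \<in> mat_kernel (A ^\<^sub>m Suc j) \<Longrightarrow> \<exists>z\<in>mat_kernel (A ^\<^sub>m j). \<exists>c. w = z + c \<cdot>\<^sub>v v"
    and ne: "mat_kernel (A ^\<^sub>m Suc j) \<noteq> mat_kernel (A ^\<^sub>m Suc (Suc j))"
  shows "partial_isometry (A ^\<^sub>m Suc (Suc j))"
proof -
  let ?K = "\<lambda>i. mat_kernel (A ^\<^sub>m i)" and ?M = "\<lambda>i. orth_compl n (mat_kernel (A ^\<^sub>m i))"
  have piA: "partial_isometry A" using pi[of 1] pow_1 by simp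
  have piI: "partial_isometry (A ^\<^sub>m j)" "partial_isometry (A ^\<^sub>m Suc j)"
    using pi by (simp_all del: pow_mat.simps)
  note step = ppi_step[OF piA piI]
  obtain x0 where x0: "x0 \<in> ?K (Suc (Suc j))" "x0 \<notin> ?K (Suc j)"
    using ne pow_kernel_mono[of "Suc j" "Suc (Suc j)"] by auto
  have x0c: "x0 \<in> carrier_vec n" using x0(1) pow_kernel_iff by blast
  \<comment> \<open>Dropping the part in \<open>?K (Suc j)\<close> leaves a new kernel direction
    \<open>x\<close> in a space on which \<open>A\<close> is isometric.\<close>
  obtain p x where px: "p \<in> ?K (Suc j)" "x \<in> ?M (Suc j)" "x0 = p + x"
    using kernel_decomp[OF pow_carrier x0c] .
  have pc: "p \<in> carrier_vec n" and xc: "x \<in> carrier_vec n"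
    using px(1,2) pow_kernel_iff by (blast, simp add: orth_compl_def)
  have K: "linear_subspace n (?K i)" for i using linear_subspace_kernel[OF pow_carrier] .
  have "x = x0 + (-1) \<cdot>\<^sub>v p" unfolding px(3) using pc xc by (auto intro!: eq_vecI)
  moreover have "p \<in> ?K (Suc (Suc j))" using px pow_kernel_mono[of "Suc j" "Suc (Suc j)"] by auto
  ultimately have xK: "x \<in> ?K (Suc (Suc j))"
    using K[of "Suc (Suc j)"] x0(1) unfolding linear_subspace_def by metis
  have xnK: "x \<notin> ?K (Suc j)"
    using px x0(2) K[of "Suc j"] unfolding linear_subspace_def by metis
  have AxK: "A *\<^sub>v x \<in> ?K (Suc j)"
    using pow_kernel_add_iff[of x "Suc j" 1] xK pow_1 by simp
  have AxnK: "A *\<^sub>v x \<notin> ?K j"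
    using pow_kernel_add_iff[of x j 1] xnK xc pow_1 by simp
  \<comment> \<open>Modulo \<open>?K j\<close>, \<open>A *\<^sub>v x\<close> is a nonzero multiple
    of \<open>v\<close> and every element of \<open>?K (Suc j)\<close> a multiple of
    \<open>v\<close>, so one more orthogonality condition suffices.\<close>
  have orth: "w \<bullet>c (A *\<^sub>v x) = 0 \<Longrightarrow> w \<in> ?M j \<Longrightarrow> w \<in> ?M (Suc j)" for w
  proof -
    assume w0: "w \<bullet>c (A *\<^sub>v x) = 0" and wM: "w \<in> ?M j"
    have wc: "w \<in> carrier_vec n" using wM by (simp add: orth_compl_def)
    obtain z c where zc: "z \<in> ?K j" "A *\<^sub>v x = z + c \<cdot>\<^sub>v v" using span[OF AxK] by auto
    have zcar: "z \<in> carrier_vec n" using zc by (simp add: pow_kernel_iff)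
    have "z + 0 \<cdot>\<^sub>v v = z" using zcar v by (auto intro!: eq_vecI)
    then have c0: "c \<noteq> 0" using AxnK zc by auto
    have "w \<bullet>c z = 0" using wM zc by (simp add: orth_compl_def)
    then have wv: "w \<bullet>c v = 0"
      using w0 c0 unfolding zc(2) using wc zcar v by (simp add: cscalar_simps[of _ n])
    have "w \<bullet>c y = 0" if yK: "y \<in> ?K (Suc j)" for y
    proof -
      obtain z c where zc: "z \<in> ?K j" "y = z + c \<cdot>\<^sub>v v" using span[OF yK] by auto
      then have "z \<in> carrier_vec n" "w \<bullet>c z = 0" using wM by (auto simp: pow_kernel_iff orth_compl_def)
      then show ?thesis unfolding zc(2) using wc v wv by (simp add: cscalar_simps[of _ n])
    qed
    then show ?thesis using wc by (simp add: orth_compl_def)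
  qed
  have sub: "linear_subspace n (?M (Suc j))"
    by (rule linear_subspace_orth_compl) (use pow_kernel_iff in blast)
  show ?thesis
  proof (rule partial_isometryI[OF pow_carrier])
    fix z assume z: "z \<in> ?M (Suc (Suc j))"
    then have zM: "z \<in> ?M (Suc j)" using orth_compl_pow_kernel_mono[of "Suc j" "Suc (Suc j)"] by auto
    have "z \<bullet>c x = 0" using z xK by (simp add: orth_compl_def)
    then have "(A *\<^sub>v z) \<bullet>c (A *\<^sub>v x) = 0"
      using isometric_preserves_orthogonality[OF A sub step(1) px(2) zM] by simp
    then have "A *\<^sub>v z \<in> ?M (Suc j)" using orth step(2) zM by simp
    then have "(A ^\<^sub>m Suc j *\<^sub>v (A *\<^sub>v z)) \<bullet>c (A ^\<^sub>m Suc j *\<^sub>v (A *\<^sub>v z)) = (A *\<^sub>v z) \<bullet>c (A *\<^sub>v z)"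
      using partial_isometryD[OF pi[of "Suc j"] pow_carrier] by simp
    moreover have "A ^\<^sub>m Suc (Suc j) *\<^sub>v z = A ^\<^sub>m Suc j *\<^sub>v (A *\<^sub>v z)"
      using pow_mat_add_vec[OF A, of z "Suc j" 1] zM pow_1 by (simp add: orth_compl_def)
    ultimately show "(A ^\<^sub>m Suc (Suc j) *\<^sub>v z) \<bullet>c (A ^\<^sub>m Suc (Suc j) *\<^sub>v z) = z \<bullet>c z"
      using step(1)[OF zM] by simp
  qed
qed

lemma partial_isometry_pow_0: "partial_isometry (A ^\<^sub>m 0)"
  using A by (intro partial_isometryI[OF pow_carrier]) (auto simp: orth_compl_def)

text \<open>The complement of the kernel is zero, since its vectors are orthogonal to
  themselves.\<close>

lemma partial_isometry_beyond_nilpotency: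
  assumes "mat_kernel (A ^\<^sub>m k) = carrier_vec n" "k \<le> l"
  shows "partial_isometry (A ^\<^sub>m l)"
proof (rule partial_isometryI[OF pow_carrier])
  fix x assume x: "x \<in> orth_compl n (mat_kernel (A ^\<^sub>m l))"
  then have xc: "x \<in> carrier_vec n" by (simp add: orth_compl_def)
  then have "x \<in> mat_kernel (A ^\<^sub>m l)" using assms pow_kernel_mono by blast
  then have "x \<bullet>c x = 0" "A ^\<^sub>m l *\<^sub>v x = 0\<^sub>v n" using x by (auto simp: orth_compl_def pow_kernel_iff)
  then show "(A ^\<^sub>m l *\<^sub>v x) \<bullet>c (A ^\<^sub>m l *\<^sub>v x) = x \<bullet>c x" by simp
qed

section \<open>Necessity: bounds relating index, ascent and size\<close>

text \<open>Otherwise the powers at the ascent and one beyond it are partial isometries, and then so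
  is \<open>A ^\<^sub>m Suc j\<close>.\<close>

lemma ppi_index_le_ascent:
  assumes p: "ppi_index A = enat j"
  shows "j \<le> ascent A"
proof (rule ccontr)
  assume less: "\<not> j \<le> ascent A"
  have pi: "\<And>i. i \<le> j \<Longrightarrow> partial_isometry (A ^\<^sub>m i)" and npi: "\<not> partial_isometry (A ^\<^sub>m Suc j)"
    using p ppi_index_eq_iff[OF partial_isometry_pow_0] by auto
  have "partial_isometry A" using pi[of 1] less pow_1 by simp
  then have "partial_isometry (A ^\<^sub>m Suc j)"
    using partial_isometry_beyond_ascent[OF ascent_kernel, of "Suc j"]
      pi[of "ascent A"] pi[of "Suc (ascent A)"] less by simp
  then show False using npi by simp
qed

text \<open>A Jordan chain \<open>U\<close> of length \<open>k\<close> refines the filtration by kernels: for \<open>i < j\<close>, the space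
  \<open>E i\<close> lies strictly between the \<open>i\<close>-th and the next kernel.\<close>

lemma ppi_index_plus_ascent:
  assumes p: "ppi_index A = enat j" and less: "j < ascent A"
  shows "j + ascent A \<le> n"
    and "j + ascent A = n \<Longrightarrow> mat_kernel (A ^\<^sub>m ascent A) = carrier_vec n"
proof -
  define k where "k = ascent A"
  let ?K = "\<lambda>i. mat_kernel (A ^\<^sub>m i)"
  have jk: "j < k" using less by (simp add: k_def)
  have pi: "\<And>i. i \<le> j \<Longrightarrow> partial_isometry (A ^\<^sub>m i)" and npi: "\<not> partial_isometry (A ^\<^sub>m Suc j)"
    using p ppi_index_eq_iff[OF partial_isometry_pow_0] by auto
  have strict: "?K i \<subset> ?K (Suc i)" if "i < k" for i
    using that ascent_strict by (simp add: k_def)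
  obtain u where u: "u \<in> ?K k" "u \<notin> ?K (k - 1)"
    using strict[of "k - 1"] jk by fastforce
  have uc: "u \<in> carrier_vec n" using u(1) pow_kernel_iff by blast
  \<comment> \<open>The chain descends from a \<open>u\<close> of exact order \<open>k\<close>, so
    for \<open>i < k\<close> the vector \<open>U i\<close> has exact order
    \<open>i + 1\<close>.\<close>
  define U where "U i = A ^\<^sub>m (k - Suc i) *\<^sub>v u" for i
  have Uc: "U i \<in> carrier_vec n" for i using pow_vec_carrier[OF uc] by (simp add: U_def)
  have UK: "U i \<in> ?K (Suc i)" "U i \<notin> ?K i" if "i < k" for i
    using pow_kernel_add_iff[of u "Suc i" "k - Suc i"] pow_kernel_add_iff[of u i "k - Suc i"] that u uc
    by (auto simp: U_def simp del: pow_mat.simps)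
  have K: "linear_subspace n (?K i)" for i using linear_subspace_kernel[OF pow_carrier] .
  have K_carrier: "z \<in> ?K i \<Longrightarrow> z \<in> carrier_vec n" for z i using pow_kernel_iff by blast
  define E where "E i = {z + c \<cdot>\<^sub>v U i | z c. z \<in> ?K i}" for i
  have E_subspace: "linear_subspace n (E i)" for i
  proof -
    have "0\<^sub>v n + 0 \<cdot>\<^sub>v U i = 0\<^sub>v n" using Uc[of i] by (auto intro!: eq_vecI)
    then have "0\<^sub>v n \<in> E i" using K[of i] unfolding E_def linear_subspace_def by fastforce
    moreover have "x + y \<in> E i" if xy: "x \<in> E i" "y \<in> E i" for x y
    proof -
      obtain z c z' c' where *: "x = z + c \<cdot>\<^sub>v U i" "y = z' + c' \<cdot>\<^sub>v U i" "z \<in> ?K i" "z' \<in> ?K i"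
        using xy by (auto simp: E_def)
      have "x + y = (z + z') + (c + c') \<cdot>\<^sub>v U i"
        using K_carrier[OF *(3)] K_carrier[OF *(4)] Uc[of i] unfolding *(1,2)
        by (intro eq_vecI) (auto simp: algebra_simps)
      moreover have "z + z' \<in> ?K i" using * K[of i] unfolding linear_subspace_def by blast
      ultimately show ?thesis unfolding E_def by blast
    qed
    moreover have "a \<cdot>\<^sub>v x \<in> E i" if xE: "x \<in> E i" for x a
    proof -
      obtain z c where *: "x = z + c \<cdot>\<^sub>v U i" "z \<in> ?K i" using xE by (auto simp: E_def)
      have "a \<cdot>\<^sub>v x = a \<cdot>\<^sub>v z + (a * c) \<cdot>\<^sub>v U i"
        using K_carrier[OF *(2)] Uc[of i] unfolding *(1)
        by (intro eq_vecI) (auto simp: algebra_simps)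
      moreover have "a \<cdot>\<^sub>v z \<in> ?K i" using * K[of i] unfolding linear_subspace_def by blast
      ultimately show ?thesis unfolding E_def by blast
    qed
    moreover have "E i \<subseteq> carrier_vec n" using K_carrier Uc by (auto simp: E_def)
    ultimately show ?thesis by (simp add: linear_subspace_def)
  qed
  have KE: "?K i \<subset> E i" if "i < k" for i
  proof -
    have "z \<in> E i" if "z \<in> ?K i" for z
    proof -
      have "z = z + 0 \<cdot>\<^sub>v U i" using K_carrier[OF that] Uc[of i] by auto
      then show ?thesis using that unfolding E_def by blast
    qed
    moreover have "U i \<in> E i"
    proof -
      have "U i = 0\<^sub>v n + 1 \<cdot>\<^sub>v U i" using Uc[of i] by auto
      then show ?thesis using K[of i] unfolding E_def linear_subspace_def by blast
    qed
    ultimately show ?thesis using UK(2)[OF that] by blast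
  qed
  have EK: "E i \<subset> ?K (Suc i)" if ij: "i < j" for i
  proof -
    have "E i \<subseteq> ?K (Suc i)"
    proof
      fix x assume "x \<in> E i"
      then obtain z c where *: "x = z + c \<cdot>\<^sub>v U i" "z \<in> ?K i" by (auto simp: E_def)
      have "z \<in> ?K (Suc i)" "U i \<in> ?K (Suc i)"
        using *(2) pow_kernel_mono[of i "Suc i"] UK(1)[of i] jk that by auto
      then show "x \<in> ?K (Suc i)" using K[of "Suc i"] *(1) unfolding linear_subspace_def by blast
    qed
    moreover have "E i \<noteq> ?K (Suc i)"
    proof
      assume eq: "E i = ?K (Suc i)"
      obtain j' where j': "j = Suc j'" using ij by (cases j) auto
      \<comment> \<open>An increment of one propagates upwards: \<open>A ^\<^sub>m d\<close> embeds
        \<open>?K (Suc j')\<close> modulo \<open>?K j'\<close> into \<open>?K (Suc i)\<close> modulo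
        \<open>?K i\<close>, taking \<open>U j'\<close> to \<open>U i\<close>.\<close>
      have "\<exists>z\<in>?K j'. \<exists>c. w = z + c \<cdot>\<^sub>v U j'" if w: "w \<in> ?K (Suc j')" for w
      proof -
        have wc: "w \<in> carrier_vec n" using K_carrier[OF w] .
        define d where "d = j' - i"
        have d: "j' = i + d" using \<open>i < j\<close> j' by (simp add: d_def)
        have "A ^\<^sub>m d *\<^sub>v w \<in> E i"
          using pow_kernel_add_iff[of w "Suc i" d] w d eq by (simp del: pow_mat.simps)
        then obtain z c where zc: "A ^\<^sub>m d *\<^sub>v w = z + c \<cdot>\<^sub>v U i" "z \<in> ?K i" by (auto simp: E_def)
        have Ud: "U i = A ^\<^sub>m d *\<^sub>v U j'"
          using pow_mat_add_vec[OF A uc, of d "k - Suc j'"] d jk j' by (simp add: U_def)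
        let ?y = "w + (- c) \<cdot>\<^sub>v U j'"
        have "A ^\<^sub>m d *\<^sub>v ?y = A ^\<^sub>m d *\<^sub>v w + (- c) \<cdot>\<^sub>v (A ^\<^sub>m d *\<^sub>v U j')"
          using wc Uc[of j'] by (simp add: mult_add_distrib_mat_vec[OF pow_carrier] mult_mat_vec[OF pow_carrier])
        also have "\<dots> = z"
          unfolding zc(1) Ud[symmetric] using K_carrier[OF zc(2)] Uc[of i] by (auto intro!: eq_vecI)
        finally have "?y \<in> ?K j'"
          using pow_kernel_add_iff[of ?y i d] zc(2) wc Uc[of j'] d by simp
        moreover have "w = ?y + c \<cdot>\<^sub>v U j'" using wc Uc[of j'] by (auto intro!: eq_vecI)
        ultimately show ?thesis by blast
      qed
      then have "partial_isometry (A ^\<^sub>m Suc (Suc j'))"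
        using partial_isometry_Suc_if_increment_1[of j' "U j'"] pi Uc strict[of j] jk unfolding j' by blast
      then show False using npi j' by simp
    qed
    ultimately show ?thesis by blast
  qed
  \<comment> \<open>The chain \<open>?K 0\<close>, \<open>E 0\<close>, \<open>?K 1\<close>,
    \<open>E 1\<close>, ... reaches \<open>?K j\<close> at position \<open>2 * j\<close> and then
    follows the remaining kernels, so \<open>?K k\<close> has position \<open>j + k\<close>.\<close>
  define V where "V t = (if t < 2 * j then if even t then ?K (t div 2) else E (t div 2) else ?K (t - j))" for t
  have V_subspace: "linear_subspace n (V t)" for t
    using K E_subspace by (simp add: V_def)
  have V_strict: "V t \<subset> V (Suc t)" if t: "t < j + k" for t
  proof -
    consider (ev) i where "t = 2 * i" "i < j" | (od) i where "t = Suc (2 * i)" "i < j" | (ge) "2 * j \<le> t"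
      by (metis evenE mult_less_cancel1 not_le oddE Suc_eq_plus1 Suc_lessD nat_mult_less_cancel1 pos2)
    then show ?thesis
    proof cases
      case ev
      then show ?thesis using KE[of i] jk by (simp add: V_def)
    next
      case od
      have "V (Suc t) = ?K (Suc i)"
        using od by (cases "Suc i = j") (auto simp: V_def simp del: pow_mat.simps)
      moreover have "V t = E i" using od by (simp add: V_def)
      ultimately show ?thesis using EK[OF od(2)] by simp
    next
      case ge
      then show ?thesis using strict[of "t - j"] t by (simp add: V_def Suc_diff_le del: pow_mat.simps)
    qed
  qed
  have "V (j + k) = ?K k" using jk by (simp add: V_def)
  then show "j + ascent A \<le> n" "j + ascent A = n \<Longrightarrow> mat_kernel (A ^\<^sub>m ascent A) = carrier_vec n"
    using subspace_chain[of "j + k" n V, OF V_subspace V_strict] by (simp_all add: k_def)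
qed

lemma ppi_index_ascent_bounds:
  assumes p: "ppi_index A = enat j" and k: "ascent A = k"
  shows "j = k \<and> k < n \<or> j < k \<and> j + k < n \<or> Suc j < k \<and> j + k = n"
proof -
  have npi: "\<not> partial_isometry (A ^\<^sub>m Suc j)"
    using p ppi_index_eq_iff[OF partial_isometry_pow_0] by auto
  then have not_full: "mat_kernel (A ^\<^sub>m k) \<noteq> carrier_vec n" if "k \<le> Suc j"
    using partial_isometry_beyond_nilpotency that by blast
  consider "j = k" | "j < k" using ppi_index_le_ascent[OF p] k by linarith
  then show ?thesis
  proof cases
    case 1
    \<comment> \<open>With \<open>k = n\<close> the \<open>n\<close> strict inclusions exhaust the
      space, which \<open>not_full\<close> excludes when \<open>j = k\<close>.\<close>
    have "mat_kernel (A ^\<^sub>m n) = carrier_vec n" if "k = n"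
      using subspace_chain(2)[of n n "\<lambda>i. mat_kernel (A ^\<^sub>m i)"] ascent_strict that k
        linear_subspace_kernel[OF pow_carrier] by blast
    then show ?thesis using not_full 1 ascent_le k by (cases "k = n") auto
  next
    case 2
    then show ?thesis using ppi_index_plus_ascent[OF p] not_full k by fastforce
  qed
qed

end

section \<open>Weighted shifts\<close>

text \<open>\<open>lev x\<close> is the largest \<open>i\<close> such that the \<open>i\<close>-th power does not annihilate the \<open>x\<close>-th basis
  vector. Each row \<open>y\<close> has at most one nonzero entry \<open>w y\<close>, in column \<open>g y\<close>.\<close>

locale weighted_shift =
  fixes n j k :: nat and g :: "nat \<Rightarrow> nat" and w :: "nat \<Rightarrow> complex" and lev :: "nat \<Rightarrow> enat"
    and s b :: nat
  assumes g: "y < n \<Longrightarrow> g y < n"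
    and lev_g: "y < n \<Longrightarrow> w y \<noteq> 0 \<Longrightarrow> eSuc (lev y) \<le> lev (g y)"
    and lev_exact: "y < n \<Longrightarrow> w y \<noteq> 0 \<Longrightarrow> eSuc (lev y) < enat j \<Longrightarrow> lev (g y) = eSuc (lev y)"
    and onto: "x < n \<Longrightarrow> 1 \<le> lev x \<Longrightarrow> \<exists>y<n. g y = x \<and> w y \<noteq> 0 \<and> lev x = eSuc (lev y)"
    and col_norm: "0 < j \<Longrightarrow> x < n \<Longrightarrow> 1 \<le> lev x \<Longrightarrow> (\<Sum>y | y < n \<and> g y = x. (cmod (w y))\<^sup>2) = 1"
    and s: "s < n" "enat (Suc j) \<le> lev s"
    and b: "b < n" "enat j \<le> lev b" "g b = s" "cmod (w b) < 1"
    and b_unique: "y < n \<Longrightarrow> g y = s \<Longrightarrow> enat j \<le> lev y \<Longrightarrow> w y \<noteq> 0 \<Longrightarrow> y = b"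
    and levels: "i < k \<Longrightarrow> \<exists>x<n. lev x = enat i" "x < n \<Longrightarrow> lev x \<noteq> enat k"
begin

definition A :: "complex mat" where
  "A = mat n n (\<lambda>(y, x). if x = g y then w y else 0)"

lemma A: "A \<in> carrier_mat n n"
  by (simp add: A_def)

lemma A_index:
  assumes "v \<in> carrier_vec n" "y < n"
  shows "(A *\<^sub>v v) $ y = w y * v $ g y"
proof -
  have "(A *\<^sub>v v) $ y = (\<Sum>x = 0..<n. if x = g y then w y * v $ x else 0)"
    using assms by (auto simp: A_def scalar_prod_def if_distrib[of "\<lambda>a. a * _"] cong: if_cong)
  also have "\<dots> = w y * v $ g y" using g[OF assms(2)] by (simp add: sum.delta)
  finally show ?thesis .
qed

definition V :: "nat \<Rightarrow> complex vec set" where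
  "V i = {v \<in> carrier_vec n. \<forall>x<n. enat i \<le> lev x \<longrightarrow> v $ x = 0}"

definition W :: "nat \<Rightarrow> complex vec set" where
  "W i = {v \<in> carrier_vec n. \<forall>x<n. lev x < enat i \<longrightarrow> v $ x = 0}"

text \<open>By \<open>lev_g\<close>, a row of level at least \<open>i\<close> only reads a column of
  level at least \<open>i + 1\<close>; by \<open>onto\<close>, each coordinate of positive level is
  read by a row exactly one level lower.\<close>

lemma A_V_iff:
  assumes v: "v \<in> carrier_vec n"
  shows "A *\<^sub>v v \<in> V i \<longleftrightarrow> v \<in> V (Suc i)"
proof
  assume Av: "A *\<^sub>v v \<in> V i"
  have "v $ x = 0" if x: "x < n" "enat (Suc i) \<le> lev x" for x
  proof -
    have "1 \<le> lev x" using x(2) by (metis eSuc_enat ileI1 not_less_iff_gr_or_eq order.trans one_eSuc eSuc_ile_mono zero_le)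
    then obtain y where y: "y < n" "g y = x" "w y \<noteq> 0" "lev x = eSuc (lev y)" using onto x by blast
    then have "enat i \<le> lev y" using x by (simp add: eSuc_enat[symmetric])
    then have "(A *\<^sub>v v) $ y = 0" using Av y by (simp add: V_def)
    then show ?thesis using A_index[OF v y(1)] y by simp
  qed
  then show "v \<in> V (Suc i)" using v by (simp add: V_def)
next
  assume vV: "v \<in> V (Suc i)"
  have "(A *\<^sub>v v) $ y = 0" if y: "y < n" "enat i \<le> lev y" for y
  proof (cases "w y = 0")
    case False
    have "eSuc (enat i) \<le> eSuc (lev y)" using y by simp
    then have "enat (Suc i) \<le> lev (g y)" using lev_g[OF y(1) False] unfolding eSuc_enat by (rule order.trans)
    then have "v $ g y = 0" using vV g y by (simp add: V_def)
    then show ?thesis using A_index[OF v y(1)] by simp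
  qed (use A_index[OF v y(1)] in simp)
  then show "A *\<^sub>v v \<in> V i" using A v by (simp add: V_def)
qed

lemma kernel_pow: "mat_kernel (A ^\<^sub>m i) = V i"
proof (induction i)
  case 0
  have "mat_kernel (A ^\<^sub>m 0) = {0\<^sub>v n}"
    using A by (auto simp: mat_kernel[of _ n n])
  also have "\<dots> = V 0" by (auto simp: V_def zero_enat_def[symmetric])
  finally show ?case .
next
  case (Suc i)
  have "v \<in> mat_kernel (A ^\<^sub>m Suc i) \<longleftrightarrow> v \<in> V (Suc i)" for v
  proof (cases "v \<in> carrier_vec n")
    case True
    then show ?thesis
      using pow_kernel_add_iff[OF A, of v i 1] pow_1[OF A] A_V_iff[OF True, of i] Suc by simp
  next
    case False
    then show ?thesis using pow_kernel_iff[OF A, of v "Suc i"] by (simp add: V_def)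
  qed
  then show ?case by blast
qed

lemma ascent_A: "ascent A = k"
  unfolding ascent_def
proof (rule Least_equality)
  have "enat k \<le> lev x \<longleftrightarrow> enat (k + 1) \<le> lev x" if "x < n" for x
    using levels(2)[OF that] by (cases "lev x") auto
  then show "mat_kernel (A ^\<^sub>m k) = mat_kernel (A ^\<^sub>m (k + 1))"
    unfolding kernel_pow by (auto simp: V_def)
next
  fix i assume eq: "mat_kernel (A ^\<^sub>m i) = mat_kernel (A ^\<^sub>m (i + 1))"
  show "k \<le> i"
  proof (rule ccontr)
    assume "\<not> k \<le> i"
    then obtain x where x: "x < n" "lev x = enat i" using levels(1)[of i] by auto
    then have "unit_vec n x \<in> V (i + 1)" "unit_vec n x \<notin> V i" by (auto simp: V_def)
    then show False using eq unfolding kernel_pow by simp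
  qed
qed

lemma orth_compl_V: "orth_compl n (V i) = W i"
proof -
  have "v \<in> W i" if v: "v \<in> orth_compl n (V i)" for v
  proof -
    have vc: "v \<in> carrier_vec n" using v by (simp add: orth_compl_def)
    have "v $ x = 0" if x: "x < n" "lev x < enat i" for x
    proof -
      have "unit_vec n x \<in> V i" using x by (auto simp: V_def)
      then have "v \<bullet>c unit_vec n x = 0" using v by (simp add: orth_compl_def)
      moreover have "conjugate (unit_vec n x) = (unit_vec n x :: complex vec)"
        by (auto intro!: eq_vecI simp: unit_vec_def)
      ultimately show ?thesis using vc x by simp
    qed
    then show ?thesis using vc by (simp add: W_def)
  qed
  moreover have "v \<bullet>c u = 0" if "v \<in> W i" "u \<in> V i" for v u
    unfolding scalar_prod_def using that by (intro sum.neutral) (force simp: V_def W_def not_le)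
  ultimately show ?thesis by (auto simp: orth_compl_def W_def)
qed

text \<open>Each row has at most one nonzero entry, so the columns are orthogonal. Grouping rows by
  \<open>g\<close> leaves the squared column norms, equal to one at positive levels.\<close>

lemma A_isometric:
  assumes "0 < j" and v: "v \<in> W 1"
  shows "(A *\<^sub>v v) \<bullet>c (A *\<^sub>v v) = v \<bullet>c v"
proof -
  have vc: "v \<in> carrier_vec n" using v by (simp add: W_def)
  have "(A *\<^sub>v v) \<bullet>c (A *\<^sub>v v) = (\<Sum>y<n. w y * v $ g y * cnj (w y * v $ g y))"
    unfolding scalar_prod_def using A
    by (intro sum.cong) (auto simp: A_index[OF vc] simp del: index_mult_mat_vec)
  also have "\<dots> = (\<Sum>y<n. complex_of_real ((cmod (w y))\<^sup>2) * (v $ g y * cnj (v $ g y)))"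
    by (simp add: complex_norm_square mult_ac del: of_real_power)
  also have "\<dots> = (\<Sum>x<n. \<Sum>y | y \<in> {..<n} \<and> g y = x. complex_of_real ((cmod (w y))\<^sup>2) * (v $ g y * cnj (v $ g y)))"
    by (rule sum.group[symmetric]) (use g in auto)
  also have "\<dots> = (\<Sum>x<n. complex_of_real (\<Sum>y | y < n \<and> g y = x. (cmod (w y))\<^sup>2) * (v $ x * cnj (v $ x)))"
    by (simp add: sum_distrib_right)
  also have "\<dots> = (\<Sum>x<n. v $ x * cnj (v $ x))"
  proof (rule sum.cong[OF refl])
    fix x assume "x \<in> {..<n}"
    then have x: "x < n" by simp
    show "complex_of_real (\<Sum>y | y < n \<and> g y = x. (cmod (w y))\<^sup>2) * (v $ x * cnj (v $ x)) = v $ x * cnj (v $ x)"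
    proof (cases "1 \<le> lev x")
      case True
      then show ?thesis using col_norm[OF assms(1) x] by simp
    next
      case False
      then have "v $ x = 0" using v x by (simp add: W_def one_enat_def not_le)
      then show ?thesis by simp
    qed
  qed
  also have "\<dots> = v \<bullet>c v" using vc by (auto simp: scalar_prod_def lessThan_atLeast0)
  finally show ?thesis .
qed

text \<open>For rows of level below \<open>i\<close>, \<open>lev_exact\<close> makes the column
  level exactly one higher, hence at most \<open>i\<close>, where \<open>v\<close> vanishes.\<close>

lemma A_W:
  assumes v: "v \<in> W (Suc i)" and "i < j"
  shows "A *\<^sub>v v \<in> W i"
proof -
  have vc: "v \<in> carrier_vec n" using v by (simp add: W_def)
  have "(A *\<^sub>v v) $ y = 0" if y: "y < n" "lev y < enat i" for y
  proof (cases "w y = 0")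
    case False
    have *: "eSuc (lev y) < enat (Suc i)" using y(2) by (simp add: eSuc_enat[symmetric])
    also have "\<dots> \<le> enat j" using assms(2) by simp
    finally have "lev (g y) = eSuc (lev y)" using lev_exact[OF y(1) False] by simp
    then have "v $ g y = 0" using v * g[OF y(1)] by (simp add: W_def)
    then show ?thesis using A_index[OF vc y(1)] by simp
  qed (use A_index[OF vc y(1)] in simp)
  then show ?thesis using A vc by (simp add: W_def)
qed

lemma pow_isometric:
  "i \<le> j \<Longrightarrow> v \<in> W i \<Longrightarrow> (A ^\<^sub>m i *\<^sub>v v) \<bullet>c (A ^\<^sub>m i *\<^sub>v v) = v \<bullet>c v"
proof (induction i arbitrary: v)
  case 0
  then show ?case using A by (simp add: W_def)
next
  case (Suc i)
  have vc: "v \<in> carrier_vec n" using Suc.prems by (simp add: W_def)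
  have "A ^\<^sub>m Suc i *\<^sub>v v = A ^\<^sub>m i *\<^sub>v (A *\<^sub>v v)"
    using pow_mat_add_vec[OF A vc, of i 1] pow_1[OF A] by simp
  moreover have "v \<in> W 1"
  proof -
    have "enat 1 \<le> enat (Suc i)" by simp
    then show ?thesis using Suc.prems(2) unfolding W_def by (blast intro: order.strict_trans2)
  qed
  ultimately show ?case using Suc A_W[of v i] A_isometric by simp
qed

text \<open>The basis vector \<open>e\<close> at \<open>s\<close> is orthogonal to the kernel. Its
  image is \<open>w b \<cdot>\<^sub>v f\<close> plus a part killed by \<open>A ^\<^sub>m j\<close>,
  so the next power shrinks its norm to \<open>cmod (w b) < 1\<close>.\<close>

lemma not_partial_isometry: "\<not> partial_isometry (A ^\<^sub>m Suc j)"
proof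
  assume pi: "partial_isometry (A ^\<^sub>m Suc j)"
  define e where "e = (unit_vec n s :: complex vec)"
  define f where "f = (unit_vec n b :: complex vec)"
  define u where "u = vec n (\<lambda>y. if g y = s \<and> y \<noteq> b then w y else 0)"
  have c: "e \<in> carrier_vec n" "f \<in> carrier_vec n" "u \<in> carrier_vec n"
    by (simp_all add: e_def f_def u_def)
  have "e \<in> W (Suc j)" using s by (auto simp: W_def e_def)
  then have "e \<in> orth_compl n (mat_kernel (A ^\<^sub>m Suc j))"
    unfolding kernel_pow orth_compl_V .
  note iso = partial_isometryD[OF pi pow_carrier[OF A] this]
  have "f \<in> W j" using b by (auto simp: W_def f_def)
  note iso' = pow_isometric[OF order.refl this]
  have unit: "unit_vec n i \<bullet>c unit_vec n i = (1 :: complex)" if "i < n" for i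
    using that by simp
  have "u \<in> V j" using b_unique by (auto simp: V_def u_def)
  then have u0: "A ^\<^sub>m j *\<^sub>v u = 0\<^sub>v n" using kernel_pow pow_kernel_iff[OF A] by blast
  have "A *\<^sub>v e = u + w b \<cdot>\<^sub>v f"
  proof (rule eq_vecI)
    fix y assume "y < dim_vec (u + w b \<cdot>\<^sub>v f)"
    then have y: "y < n" by (simp add: f_def)
    then show "(A *\<^sub>v e) $ y = (u + w b \<cdot>\<^sub>v f) $ y"
      using A_index[OF c(1) y] g[OF y] s b by (auto simp: e_def f_def u_def)
  qed (use A in \<open>simp add: f_def\<close>)
  then have "A ^\<^sub>m Suc j *\<^sub>v e = A ^\<^sub>m j *\<^sub>v (u + w b \<cdot>\<^sub>v f)"
    using pow_mat_add_vec[OF A c(1), of j 1] pow_1[OF A] by simp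
  also have "\<dots> = w b \<cdot>\<^sub>v (A ^\<^sub>m j *\<^sub>v f)"
    using c pow_carrier[OF A, of j] u0 pow_vec_carrier[OF A c(2), of j]
    by (simp add: mult_add_distrib_mat_vec[OF pow_carrier[OF A]] mult_mat_vec[OF pow_carrier[OF A]])
  finally have "w b * (cnj (w b) * (f \<bullet>c f)) = e \<bullet>c e"
    using iso iso' pow_vec_carrier[OF A c(2), of j] by (simp add: conjugate_smult_vec mult.left_commute)
  then have "w b * cnj (w b) = 1" using unit s(1) b(1) by (simp add: e_def f_def)
  then have "(cmod (w b))\<^sup>2 = 1" by (metis complex_norm_square of_real_eq_1_iff)
  then show False using b(4) norm_ge_zero[of "w b"] by (auto simp: power2_eq_1_iff)
qed

lemma ppi_index_A: "ppi_index A = enat j"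
proof -
  have "partial_isometry (A ^\<^sub>m i)" if "i \<le> j" for i
    by (rule partial_isometryI[OF pow_carrier[OF A]])
      (use pow_isometric[OF that] in \<open>simp add: kernel_pow orth_compl_V\<close>)
  then show ?thesis
    using ppi_index_eq_iff[OF partial_isometry_pow_0[OF A]] not_partial_isometry by simp
qed

end

text \<open>A nilpotent Jordan block of size \<open>c\<close>, a chain of length \<open>j\<close> fed by the vector \<open>e\<close> of index
  \<open>c + j\<close> through \<open>A e = 4/5 e' + 3/5 e\<close>, where \<open>e'\<close> is the end of that chain (absent for
  \<open>j = 0\<close>), and an identity block.\<close>

lemma exists_direct_sum_example:
  assumes "c + j < n"
  shows "\<exists>A \<in> carrier_mat n n. ppi_index A = enat j \<and> ascent A = max c j"
proof -
  define g where "g y = (if y < c + j then Suc y else y)" for y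
  \<comment> \<open>The squares of \<open>4/5\<close> and \<open>3/5\<close> sum to one, as
    \<open>col_norm\<close> demands. The zero in row \<open>c - 1\<close> separates the Jordan block
    from the chain.\<close>
  define w where "w y = (if Suc y = c then 0 else if Suc y = c + j then 4/5
    else if y = c + j then 3/5 else (1 :: complex))" for y
  \<comment> \<open>Level \<open>\<infinity>\<close> marks basis vectors that no power
    annihilates.\<close>
  define lev where "lev y = (if y < c then enat y else if y < c + j then enat (y - c) else \<infinity>)" for y
  interpret weighted_shift n j "max c j" g w lev "c + j" "c + j"
  proof
    fix x assume x: "x < n" "1 \<le> lev x"
    show "\<exists>y<n. g y = x \<and> w y \<noteq> 0 \<and> lev x = eSuc (lev y)"
    proof (cases "x < c + j")
      case True
      then have "0 < x" "x \<noteq> c" using x by (auto simp: lev_def one_enat_def zero_enat_def split: if_splits)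
      then show ?thesis using True x
        by (intro exI[of _ "x - 1"]) (auto simp: g_def w_def lev_def eSuc_enat)
    next
      case False
      then show ?thesis using x by (intro exI[of _ x]) (auto simp: g_def w_def lev_def)
    qed
    assume j: "0 < j"
    show "(\<Sum>y | y < n \<and> g y = x. (cmod (w y))\<^sup>2) = 1"
    proof (cases "x = c + j")
      case True
      have "{y. y < n \<and> g y = x} = {c + j - 1, c + j}"
        using True j x assms by (auto simp: g_def split: if_splits)
      then show ?thesis using j by (simp add: w_def norm_divide power_divide)
    next
      case False
      define y where "y = (if x < c + j then x - 1 else x)"
      have "0 < x" "x \<noteq> c" using x j by (auto simp: lev_def one_enat_def zero_enat_def split: if_splits)
      then have "{y. y < n \<and> g y = x} = {y}" "w y = 1"
        using False x by (auto simp: g_def y_def w_def split: if_splits)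
      then show ?thesis by simp
    qed
  next
    fix i assume "i < max c j"
    then show "\<exists>x<n. lev x = enat i"
      using assms by (intro exI[of _ "if i < c then i else c + i"]) (auto simp: lev_def)
  qed (use assms in \<open>auto simp: g_def w_def lev_def eSuc_enat norm_divide split: if_splits\<close>)
  show ?thesis using A ppi_index_A ascent_A by blast
qed

text \<open>Two nilpotent chains \<open>e\<^sub>0, \<dots>, e\<^sub>k\<^sub>-\<^sub>1\<close> and \<open>f\<^sub>0, \<dots>, f\<^sub>j\<^sub>-\<^sub>1\<close>, where
  \<open>e\<^sub>j\<^sub>+\<^sub>1\<close> is sent to \<open>3/5 e\<^sub>j + 4/5 f\<^sub>j\<^sub>-\<^sub>1\<close>.\<close>

lemma exists_nilpotent_example:
  assumes "Suc j < k" "j + k = n"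
  shows "\<exists>A \<in> carrier_mat n n. ppi_index A = enat j \<and> ascent A = k"
proof -
  define g where "g y = (if Suc y = n then Suc j else Suc y)" for y
  \<comment> \<open>The zero in row \<open>k - 1\<close> separates the two chains. For
    \<open>j = 0\<close> it takes precedence over \<open>4/5\<close>, as the second chain is
    empty.\<close>
  define w where "w y = (if Suc y = k then 0 else if Suc y = n then 4/5
    else if y = j then 3/5 else (1 :: complex))" for y
  \<comment> \<open>For \<open>j > 0\<close>, row \<open>n - 1\<close> of level \<open>j - 1\<close>
    reads a column of level \<open>j + 1\<close>, a jump just outside the range of
    \<open>lev_exact\<close>.\<close>
  define lev where "lev y = enat (if y < k then y else y - k)" for y
  interpret weighted_shift n j k g w lev "Suc j" j
  proof
    fix x assume x: "x < n" "1 \<le> lev x"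
    then have x0: "0 < x" "x \<noteq> k" by (auto simp: lev_def one_enat_def split: if_splits)
    then show "\<exists>y<n. g y = x \<and> w y \<noteq> 0 \<and> lev x = eSuc (lev y)"
      using x assms by (intro exI[of _ "x - 1"]) (auto simp: g_def w_def lev_def eSuc_enat)
    assume j: "0 < j"
    show "(\<Sum>y | y < n \<and> g y = x. (cmod (w y))\<^sup>2) = 1"
    proof (cases "x = Suc j")
      case True
      have "{y. y < n \<and> g y = x} = {n - 1, j}" "n - 1 \<noteq> j"
        using True j x assms by (auto simp: g_def split: if_splits)
      then show ?thesis using j assms by (simp add: w_def norm_divide power_divide)
    next
      case False
      have "{y. y < n \<and> g y = x} = {x - 1}" "w (x - 1) = 1"
        using False x x0 by (auto simp: g_def w_def split: if_splits)
      then show ?thesis by simp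
    qed
  next
    fix i assume "i < k"
    then show "\<exists>x<n. lev x = enat i"
      using assms by (intro exI[of _ i]) (auto simp: lev_def)
  qed (use assms in \<open>auto simp: g_def w_def lev_def eSuc_enat norm_divide split: if_splits\<close>)
  show ?thesis using A ppi_index_A ascent_A by blast
qed

theorem theorem3p1:
  fixes j k n :: nat
  assumes "n > 0"
  shows "(\<exists>A \<in> carrier_mat n n. ppi_index A = enat j \<and> ascent A = k) \<longleftrightarrow>
    (j = k \<and> int k \<le> int n - 1) \<or>
    (int j \<le> int k - 1 \<and> int j + int k \<le> int n - 1) \<or>
    (int j \<le> int k - 2 \<and> j + k = n)"
proof -
  have "(\<exists>A \<in> carrier_mat n n. ppi_index A = enat j \<and> ascent A = k) \<longleftrightarrow>
      j = k \<and> k < n \<or> j < k \<and> j + k < n \<or> Suc j < k \<and> j + k = n" (is "?L \<longleftrightarrow> ?R")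
  proof
    show "?L \<Longrightarrow> ?R" using ppi_index_ascent_bounds by blast
    show "?R \<Longrightarrow> ?L"
      \<comment> \<open>The case \<open>j = k\<close> takes no Jordan block; the case
        \<open>j + k < n\<close> takes one of size \<open>k\<close>.\<close>
      using exists_direct_sum_example[of 0 j n] exists_direct_sum_example[of k j n]
        exists_nilpotent_example[of j k n]
      by (auto simp: max_def add.commute split: if_splits)
  qed
  also have "?R \<longleftrightarrow> (j = k \<and> int k \<le> int n - 1) \<or>
    (int j \<le> int k - 1 \<and> int j + int k \<le> int n - 1) \<or>
    (int j \<le> int k - 2 \<and> j + k = n)"
    by auto
  finally show ?thesis .
qed

end
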